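(* Let $H$ and $K$ be cancellative monoids, and assume that $H$ contains an element of infinite order. If $g \colon H \to K$ is the pullback of an isomorphism $f \colon \mathcal P_{\mathrm{fin},1}(H) \to \mathcal P_{\mathrm{fin},1}(K)$, then \[ \nu_h(A) = \nu_{g(h)}(f(A)), \qquad \text{for all } h \in H \text{ and } A \in \mathcal P_{\mathrm{fin},1}(H). \]
   Context: Monoids are written multiplicatively and are not assumed commutative; $1_H$ is the identity of $H$. A monoid is cancellative if left multiplication and right multiplication by each of its elements are injective. An element $a$ has infinite order if its powers $a^0, a^1, a^2, \ldots$ are pairwise distinct. For a monoid $H$, $\mathcal P_{\mathrm{fin},1}(H)$ is the monoid of all finite subsets of $H$ containing $1_H$, with operation the setwise product $XY := \{xy : x \in X,\ y \in Y\}$ and identity $\{1_H\}$. It is known (Tringali--Yan) that for every isomorphism $f \colon \mathcal P_{\mathrm{fin},1}(H) \to \mathcal P_{\mathrm{fin},1}(K)$ (with $H$, $K$ arbitrary monoids) there is a (unique) bijection $g \colon H \to K$ with $f(\{1_H, x\}) = \{1_K, g(x)\}$ for every $x \in H$; this $g$ is called the pullback of $f$. For an element $h$ of a semigroup $S$ and a non-empty finite $A \subseteq S$, the (left) $h$-autocorrelation of $A$ is $\nu_h(A) := |\{a \in A : ha \in A\}|$. *)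

theory Defs
  imports "HOL-Algebra.Divisibility"
begin

definition power_monoid_fin1 :: "('a, 'm) monoid_scheme \<Rightarrow> 'a set monoid"
  where "power_monoid_fin1 H =
    \<lparr>carrier = {X. X \<subseteq> carrier H \<and> finite X \<and> \<one>\<^bsub>H\<^esub> \<in> X},
     mult = (\<lambda>X Y. X <#>\<^bsub>H\<^esub> Y),
     one = {\<one>\<^bsub>H\<^esub>}\<rparr>"

lemma (in monoid) power_monoid_fin1_is_monoid: "monoid (power_monoid_fin1 G)"
proof (rule monoidI)
  fix X Y Z
  assume "X \<in> carrier (power_monoid_fin1 G)" "Y \<in> carrier (power_monoid_fin1 G)"
    "Z \<in> carrier (power_monoid_fin1 G)"
  then have sub: "X \<subseteq> carrier G" "Y \<subseteq> carrier G" "Z \<subseteq> carrier G"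
    by (auto simp: power_monoid_fin1_def)
  have "(x \<otimes> y) \<otimes> z = x \<otimes> (y \<otimes> z)" if "x \<in> X" "y \<in> Y" "z \<in> Z" for x y z
    using that sub by (intro m_assoc) auto
  then show "X \<otimes>\<^bsub>power_monoid_fin1 G\<^esub> Y \<otimes>\<^bsub>power_monoid_fin1 G\<^esub> Z =
      X \<otimes>\<^bsub>power_monoid_fin1 G\<^esub> (Y \<otimes>\<^bsub>power_monoid_fin1 G\<^esub> Z)"
    by (simp add: power_monoid_fin1_def set_mult_def)
next
  fix X Y
  assume "X \<in> carrier (power_monoid_fin1 G)" "Y \<in> carrier (power_monoid_fin1 G)"
  then have X: "X \<subseteq> carrier G" "finite X" "\<one> \<in> X" and Y: "Y \<subseteq> carrier G" "finite Y" "\<one> \<in> Y"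
    by (simp_all add: power_monoid_fin1_def)
  have "X <#> Y \<subseteq> carrier G"
    using X(1) Y(1) unfolding set_mult_def by blast
  moreover have "finite (X <#> Y)"
    using X(2) Y(2) by (simp add: set_mult_def)
  moreover have "\<one> \<otimes> \<one> \<in> X <#> Y"
    using X(3) Y(3) unfolding set_mult_def by blast
  ultimately show "X \<otimes>\<^bsub>power_monoid_fin1 G\<^esub> Y \<in> carrier (power_monoid_fin1 G)"
    by (simp add: power_monoid_fin1_def)
next
  fix X
  assume "X \<in> carrier (power_monoid_fin1 G)"
  then have "\<one> \<otimes> x = x" "x \<otimes> \<one> = x" if "x \<in> X" for x
    using that by (auto simp: power_monoid_fin1_def)
  then show "\<one>\<^bsub>power_monoid_fin1 G\<^esub> \<otimes>\<^bsub>power_monoid_fin1 G\<^esub> X = X"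
    and "X \<otimes>\<^bsub>power_monoid_fin1 G\<^esub> \<one>\<^bsub>power_monoid_fin1 G\<^esub> = X"
    by (simp_all add: power_monoid_fin1_def set_mult_def)
qed (auto simp: power_monoid_fin1_def)

definition has_infinite_order :: "('a, 'm) monoid_scheme \<Rightarrow> 'a \<Rightarrow> bool"
  where "has_infinite_order H a \<longleftrightarrow> inj (\<lambda>n::nat. a [^]\<^bsub>H\<^esub> n)"

text \<open>
  The pullback of \<open>f\<close> is determined only on \<open>carrier H\<close>, so it is rendered as a predicate on
  total functions \<open>g\<close>; any two pullbacks of the same \<open>f\<close> agree on \<open>carrier H\<close>.
\<close>

definition is_pullback ::
  "('a, 'm) monoid_scheme \<Rightarrow> ('b, 'n) monoid_scheme \<Rightarrow> ('a set \<Rightarrow> 'b set) \<Rightarrow> ('a \<Rightarrow> 'b) \<Rightarrow> bool"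
  where "is_pullback H K f g \<longleftrightarrow>
    bij_betw g (carrier H) (carrier K) \<and>
    (\<forall>x \<in> carrier H. f {\<one>\<^bsub>H\<^esub>, x} = {\<one>\<^bsub>K\<^esub>, g x})"

lemma is_pullback_unique:
  assumes "is_pullback H K f g" "is_pullback H K f g'" "x \<in> carrier H"
  shows "g x = g' x"
proof -
  have "{\<one>\<^bsub>K\<^esub>, g x} = {\<one>\<^bsub>K\<^esub>, g' x}"
    using assms by (simp add: is_pullback_def)
  then show ?thesis
    by (auto simp: doubleton_eq_iff)
qed

definition autocorrelation :: "('a, 'm) monoid_scheme \<Rightarrow> 'a \<Rightarrow> 'a set \<Rightarrow> nat"
  where "autocorrelation H h A = card {a \<in> A. h \<otimes>\<^bsub>H\<^esub> a \<in> A}"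

end

theory Submission
  imports Defs
begin

text \<open>
  Left multiplication by \<open>h\<close> is injective and \<open>{\<one>, h} A = A \<union> h A\<close>, while \<open>A \<inter> h A\<close> has
  \<open>\<nu>\<^sub>h(A)\<close> elements. Hence \<open>\<nu>\<^sub>h(A) = 2 |A| - |{\<one>, h} A|\<close> (lemma
  \<open>card_doubleton_mult_plus_autocorrelation\<close>). An isomorphism \<open>f\<close> with pullback \<open>g\<close> sends
  \<open>{\<one>, h} A\<close> to \<open>{\<one>, g h} f(A)\<close>, so the claim follows once \<open>f\<close> is known to preserve
  cardinalities.

  The cardinality of \<open>A\<close> can be read off from the multiplication of sets, as follows. Suppose
  that \<open>c\<close> is such that the right translates \<open>A, A c, A c\<^sup>2, \<dots>\<close> are pairwise disjoint. A solution
  \<open>Y\<close> of the equation \<open>Y {\<one>, c} = A {\<one>, c}\<^sup>3\<close> has to contain \<open>A\<close> and \<open>A c\<^sup>2\<close>, it cannot leave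
  \<open>A \<union> A c \<union> A c\<^sup>2\<close>, and its trace on \<open>A c\<close> is arbitrary. So there are exactly \<open>2 ^ |A|\<close>
  solutions (lemma \<open>card_cube_roots_of_translates\<close>).

  The isomorphism \<open>f\<close> maps the solutions for \<open>A\<close> and \<open>c\<close> bijectively to those for \<open>f(A)\<close> and
  \<open>g(c)\<close>, and it remains to find a \<open>c\<close> that is good for \<open>A\<close> and whose image \<open>g(c)\<close> is good for
  \<open>f(A)\<close>. If \<open>a\<close> has infinite order, then every large power of \<open>a\<close> is good for \<open>A\<close>. Comparing the
  sets \<open>{\<one>, a}\<^sup>n = {\<one>, a, \<dots>, a\<^sup>n}\<close> with their images \<open>{\<one>, g(a)}\<^sup>n\<close> shows that \<open>g(a)\<close> has
  infinite order too and that \<open>g(a\<^sup>n) = g(a)\<^sup>n\<close>; therefore a sufficiently large power of \<open>a\<close>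
  serves both purposes.
\<close>

section \<open>Sets of consecutive powers\<close>

definition powers_upto :: "('a, 'm) monoid_scheme \<Rightarrow> 'a \<Rightarrow> nat \<Rightarrow> 'a set"
  where "powers_upto G a n = (\<lambda>i. a [^]\<^bsub>G\<^esub> i) ` {..n}"

lemma carrier_power_monoid_fin1_iff:
  "X \<in> carrier (power_monoid_fin1 G) \<longleftrightarrow> X \<subseteq> carrier G \<and> finite X \<and> \<one>\<^bsub>G\<^esub> \<in> X"
  by (simp add: power_monoid_fin1_def)

lemma mult_power_monoid_fin1: "X \<otimes>\<^bsub>power_monoid_fin1 G\<^esub> Y = X <#>\<^bsub>G\<^esub> Y"
  by (simp add: power_monoid_fin1_def)

lemma in_set_mult_iff: "z \<in> X <#>\<^bsub>G\<^esub> Y \<longleftrightarrow> (\<exists>x\<in>X. \<exists>y\<in>Y. z = x \<otimes>\<^bsub>G\<^esub> y)"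
  by (auto simp: set_mult_def)

context monoid
begin

lemma doubleton_in_power_monoid:
  "c \<in> carrier G \<Longrightarrow> {\<one>, c} \<in> carrier (power_monoid_fin1 G)"
  by (simp add: carrier_power_monoid_fin1_iff)

lemma powers_upto_in_power_monoid:
  assumes "a \<in> carrier G"
  shows "powers_upto G a n \<in> carrier (power_monoid_fin1 G)"
proof -
  have "\<one> \<in> powers_upto G a n"
    unfolding powers_upto_def by (rule image_eqI[of _ _ 0]) auto
  then show ?thesis
    using assms by (auto simp: carrier_power_monoid_fin1_iff powers_upto_def)
qed

lemma powers_upto_1:
  assumes "a \<in> carrier G"
  shows "powers_upto G a 1 = {\<one>, a}"
proof -
  have "{..1} = {0, 1::nat}" by auto
  then show ?thesis using assms by (simp add: powers_upto_def)
qed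

lemma in_mult_powers_upto_iff:
  "z \<in> A <#> powers_upto G c n \<longleftrightarrow> (\<exists>x\<in>A. \<exists>i\<le>n. z = x \<otimes> c [^] i)"
  by (auto simp: in_set_mult_iff powers_upto_def)

lemma in_mult_doubleton_iff:
  assumes "Y \<subseteq> carrier G"
  shows "z \<in> Y <#> {\<one>, c} \<longleftrightarrow> z \<in> Y \<or> (\<exists>y\<in>Y. z = y \<otimes> c)"
  using assms by (force simp: in_set_mult_iff)

lemma doubleton_mult:
  assumes "A \<subseteq> carrier G"
  shows "{\<one>, h} <#> A = A \<union> (\<lambda>x. h \<otimes> x) ` A"
proof -
  have "\<one> \<otimes> x = x" if "x \<in> A" for x
    using assms that by auto
  then show ?thesis by (auto simp: set_mult_def)
qed

text \<open>
  So for positive \<open>n\<close> the set \<open>powers_upto G a n\<close> is the power \<open>{\<one>, a}\<^sup>n\<close> in the power monoid.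
  This is what lets an isomorphism with a known value on \<open>{\<one>, a}\<close> be evaluated on it.
\<close>

lemma powers_upto_Suc:
  assumes "a \<in> carrier G"
  shows "powers_upto G a (Suc n) = powers_upto G a n <#> {\<one>, a}"
proof -
  have sub: "powers_upto G a n \<subseteq> carrier G"
    using powers_upto_in_power_monoid[OF assms] by (simp add: carrier_power_monoid_fin1_iff)
  have "z \<in> powers_upto G a (Suc n) \<longleftrightarrow> z \<in> powers_upto G a n <#> {\<one>, a}" for z
  proof -
    have "z \<in> powers_upto G a (Suc n) \<longleftrightarrow> z \<in> powers_upto G a n \<or> z = a [^] Suc n"
      unfolding powers_upto_def atMost_Suc image_insert by blast
    also have "\<dots> \<longleftrightarrow> z \<in> powers_upto G a n \<or> (\<exists>y\<in>powers_upto G a n. z = y \<otimes> a)"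
    proof -
      have "z \<in> powers_upto G a n \<or> z = a [^] Suc n" if "i \<le> n" "z = a [^] i \<otimes> a" for i
      proof (cases "i = n")
        case False
        then have "Suc i \<le> n" "z = a [^] Suc i" using that by auto
        then show ?thesis unfolding powers_upto_def by blast
      qed (use that in simp)
      then show ?thesis by (auto simp: powers_upto_def)
    qed
    finally show ?thesis using in_mult_doubleton_iff[OF sub] by simp
  qed
  then show ?thesis by blast
qed

lemma doubleton_pow_mult_powers_upto:
  assumes "a \<in> carrier G"
  shows "{\<one>, a [^] n} <#> powers_upto G a n = powers_upto G a (2 * n)"
proof -
  have sub: "powers_upto G a n \<subseteq> carrier G"
    using powers_upto_in_power_monoid[OF assms] by (simp add: carrier_power_monoid_fin1_iff)
  have split: "{..2 * n} = {..n} \<union> (+) n ` {..n}"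
  proof -
    have "i \<in> (+) n ` {..n}" if "i \<le> 2 * n" "\<not> i \<le> n" for i
      using that by (intro image_eqI[of _ _ "i - n"]) auto
    then show ?thesis by auto
  qed
  have "{\<one>, a [^] n} <#> powers_upto G a n =
      powers_upto G a n \<union> (\<lambda>i. a [^] n \<otimes> a [^] i) ` {..n}"
    using doubleton_mult[OF sub] by (simp add: powers_upto_def image_image)
  also have "(\<lambda>i. a [^] n \<otimes> a [^] i) ` {..n} = (\<lambda>i. a [^] i) ` ((+) n ` {..n})"
    using assms by (simp add: image_image nat_pow_mult)
  finally show ?thesis
    unfolding powers_upto_def split image_Un .
qed

end

section \<open>Counting in a cancellative monoid\<close>

context monoid_cancel
begin

text \<open>
  This is inclusion-exclusion for \<open>{\<one>, h} A = A \<union> h A\<close>: the map \<open>a \<mapsto> h a\<close> is injective and carries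
  the set counted by the autocorrelation onto \<open>A \<inter> h A\<close>.
\<close>

lemma card_doubleton_mult_plus_autocorrelation:
  assumes "h \<in> carrier G" and A: "A \<in> carrier (power_monoid_fin1 G)"
  shows "card ({\<one>, h} <#> A) + autocorrelation G h A = 2 * card A"
proof -
  have sub: "A \<subseteq> carrier G" and fin: "finite A"
    using A by (simp_all add: carrier_power_monoid_fin1_iff)
  have inj: "inj_on (\<lambda>x. h \<otimes> x) A"
    using l_cancel assms(1) sub by (fastforce intro: inj_onI)
  have "A \<inter> (\<lambda>x. h \<otimes> x) ` A = (\<lambda>x. h \<otimes> x) ` {a \<in> A. h \<otimes> a \<in> A}"
    by auto
  moreover have "card ((\<lambda>x. h \<otimes> x) ` {a \<in> A. h \<otimes> a \<in> A}) = autocorrelation G h A"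
    unfolding autocorrelation_def by (rule card_image) (rule inj_on_subset[OF inj], auto)
  ultimately show ?thesis
    using card_Un_Int[OF fin finite_imageI[OF fin], of "\<lambda>x. h \<otimes> x"] card_image[OF inj]
      doubleton_mult[OF sub, of h] by simp
qed

text \<open>
  For fixed \<open>x\<close> and \<open>y\<close>, cancelling \<open>x\<close> shows that \<open>x a\<^sup>m = y\<close> has at most one solution \<open>m\<close>, so the
  finitely many pairs from \<open>A\<close> exclude only finitely many exponents.
\<close>

lemma large_powers_translate_off:
  assumes a: "a \<in> carrier G" and ord: "has_infinite_order G a"
    and A: "A \<subseteq> carrier G" "finite A"
  shows "\<exists>M. \<forall>m>M. \<forall>x\<in>A. x \<otimes> a [^] (m::nat) \<notin> A"
proof -
  have "inj_on (\<lambda>m::nat. x \<otimes> a [^] m) UNIV" if "x \<in> A" for x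
    using that A(1) a ord l_cancel[of x] unfolding has_infinite_order_def inj_def by blast
  then have "finite ((\<lambda>m::nat. x \<otimes> a [^] m) -` A)" if "x \<in> A" for x
    using that A(2) by (intro finite_vimageI)
  then have "finite (\<Union>x\<in>A. (\<lambda>m::nat. x \<otimes> a [^] m) -` A)"
    using A(2) by blast
  then obtain M where "\<forall>m\<in>(\<Union>x\<in>A. (\<lambda>m::nat. x \<otimes> a [^] m) -` A). m \<le> M"
    using finite_nat_set_iff_bounded_le by blast
  then have "\<forall>m>M. \<forall>x\<in>A. x \<otimes> a [^] m \<notin> A"
    by (meson UN_I leD vimageI)
  then show ?thesis ..
qed

lemma translates_disjoint:
  assumes c: "c \<in> carrier G" and sub: "A \<subseteq> carrier G"
    and off: "\<And>x k. x \<in> A \<Longrightarrow> 0 < (k::nat) \<Longrightarrow> x \<otimes> c [^] k \<notin> A"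
    and "x \<in> A" "y \<in> A" "x \<otimes> c [^] (i::nat) = y \<otimes> c [^] (j::nat)"
  shows "i = j"
proof -
  have less: False
    if "x \<in> A" "y \<in> A" "x \<otimes> c [^] (i::nat) = y \<otimes> c [^] (j::nat)" "i < j" for x y i j
  proof -
    have xy: "x \<in> carrier G" "y \<in> carrier G" using that sub by auto
    have "c [^] j = c [^] (j - i) \<otimes> c [^] i"
      using c that(4) by (simp add: nat_pow_mult)
    then have "x \<otimes> c [^] i = (y \<otimes> c [^] (j - i)) \<otimes> c [^] i"
      using that(3) xy c by (simp add: m_assoc)
    then have "x = y \<otimes> c [^] (j - i)"
      using xy c r_cancel[of _ "c [^] i"] by blast
    then show False using off[of y "j - i"] that by auto
  qed
  from less[of x y i j] less[of y x j i] assms(4-6) show ?thesis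
    by (metis linorder_neqE_nat)
qed

text \<open>
  The exponent 3 is the least one for which the equation has any freedom. In each orbit
  \<open>x, x c, x c\<^sup>2, \<dots>\<close> one has to solve \<open>S + {0, 1} = {0, \<dots>, 3}\<close>, where \<open>0\<close> and \<open>2\<close> are forced to
  lie in \<open>S\<close> and only \<open>1\<close> can be chosen. So the solutions are the sets \<open>A \<union> B c \<union> A c\<^sup>2\<close> with
  \<open>B \<subseteq> A\<close>.
\<close>

lemma card_cube_roots_of_translates:
  assumes c: "c \<in> carrier G" and A: "A \<in> carrier (power_monoid_fin1 G)"
    and off: "\<And>x k. x \<in> A \<Longrightarrow> 0 < (k::nat) \<Longrightarrow> x \<otimes> c [^] k \<notin> A"
  shows "card {Y \<in> carrier (power_monoid_fin1 G). Y <#> {\<one>, c} = A <#> powers_upto G c 3}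
      = 2 ^ card A" (is "card ?S = _")
proof -
  have sub: "A \<subseteq> carrier G" and fin: "finite A" and one: "\<one> \<in> A"
    using A by (simp_all add: carrier_power_monoid_fin1_iff)
  note disj = translates_disjoint[OF c sub off]
  define F where "F B = A \<union> (\<lambda>x. x \<otimes> c) ` B \<union> (\<lambda>x. x \<otimes> c [^] (2::nat)) ` A" for B
  let ?T = "A <#> powers_upto G c 3"
  have pow: "x \<otimes> c [^] (0::nat) = x" "x \<otimes> c [^] (1::nat) = x \<otimes> c"
    "x \<otimes> c [^] i \<otimes> c = x \<otimes> c [^] Suc i" if "x \<in> A" for x i
    using that sub c by (auto simp: m_assoc)
  have T_iff: "z \<in> ?T \<longleftrightarrow> (\<exists>x\<in>A. \<exists>i\<le>3::nat. z = x \<otimes> c [^] i)" for z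
    by (rule in_mult_powers_upto_iff)
  have F_sub: "F B \<subseteq> carrier G" if "B \<subseteq> A" for B
    using that sub c by (auto simp: F_def)
  have F_solution: "F B \<in> ?S" if B: "B \<subseteq> A" for B
  proof -
    have F_pow: "\<exists>x\<in>A. \<exists>i\<le>2::nat. y = x \<otimes> c [^] i" if y: "y \<in> F B" for y
    proof -
      consider "y \<in> A" | x where "x \<in> A" "y = x \<otimes> c" | x where "x \<in> A" "y = x \<otimes> c [^] (2::nat)"
        using y B unfolding F_def by blast
      then show ?thesis
      proof cases
        case 1 then show ?thesis using pow(1)[of y] by (intro bexI[of _ y] exI[of _ 0]) auto
      next
        case 2 then show ?thesis using pow(2)[of x] by (intro bexI[of _ x] exI[of _ 1]) auto
      next
        case 3 then show ?thesis by blast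
      qed
    qed
    have "z \<in> F B <#> {\<one>, c} \<longleftrightarrow> z \<in> ?T" for z
    proof
      assume "z \<in> F B <#> {\<one>, c}"
      then consider "z \<in> F B" | y where "y \<in> F B" "z = y \<otimes> c"
        using in_mult_doubleton_iff[OF F_sub[OF B]] by blast
      then show "z \<in> ?T"
      proof cases
        case 1
        then obtain x i where "x \<in> A" "i \<le> (2::nat)" "z = x \<otimes> c [^] i" using F_pow[OF 1] by blast
        then show ?thesis unfolding T_iff by (intro bexI[of _ x] exI[of _ i]) auto
      next
        case 2
        then obtain x i where "x \<in> A" "i \<le> (2::nat)" "y = x \<otimes> c [^] i" using F_pow[OF 2(1)] by blast
        then show ?thesis
          unfolding T_iff using 2 pow(3) by (intro bexI[of _ x] exI[of _ "Suc i"]) auto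
      qed
    next
      assume "z \<in> ?T"
      then obtain x i where x: "x \<in> A" "i \<le> (3::nat)" "z = x \<otimes> c [^] i" unfolding T_iff by blast
      have F0: "x \<in> F B" and F2: "x \<otimes> c [^] (2::nat) \<in> F B"
        using x(1) by (auto simp: F_def)
      consider "i = 0" | "i = 1" | "i = 2" | "i = Suc 2"
        using x(2) by linarith
      then have "z \<in> F B \<or> (\<exists>y\<in>F B. z = y \<otimes> c)"
      proof cases
        case 1 then show ?thesis using x F0 pow(1)[of x] by simp
      next
        case 2 then show ?thesis using x F0 pow(2)[of x] by blast
      next
        case 3 then show ?thesis using x F2 by simp
      next
        case 4 then show ?thesis using x F2 pow(3)[of x 2] by metis
      qed
      then show "z \<in> F B <#> {\<one>, c}"
        using in_mult_doubleton_iff[OF F_sub[OF B]] by blast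
    qed
    moreover have "finite (F B)" "\<one> \<in> F B"
      using finite_subset[OF B fin] fin one by (auto simp: F_def)
    ultimately show ?thesis
      using F_sub[OF B] by (auto simp: carrier_power_monoid_fin1_iff)
  qed
  \<comment> \<open>\<open>x c\<close> can be in \<open>F B\<close> only through the middle layer, so \<open>F\<close> is injective.\<close>
  have recover: "B = {x \<in> A. x \<otimes> c \<in> F B}" if B: "B \<subseteq> A" for B
  proof -
    have "x \<in> B" if x: "x \<in> A" "x \<otimes> c \<in> F B" for x
    proof -
      have "x \<otimes> c \<notin> A"
        using off[of x 1] x(1) pow(2)[OF x(1)] by simp
      moreover have "x \<otimes> c \<noteq> y \<otimes> c [^] (2::nat)" if "y \<in> A" for y
        using disj[of x y 1 2] x(1) that pow(2)[of x] by auto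
      ultimately obtain y where y: "y \<in> B" "x \<otimes> c = y \<otimes> c"
        using x(2) unfolding F_def by blast
      then have "x = y" using r_cancel[of x c y] x(1) B sub c by blast
      then show ?thesis using y by simp
    qed
    then show ?thesis using B by (auto simp: F_def)
  qed
  have inj: "inj_on F (Pow A)"
    by (rule inj_onI) (metis recover PowD)
  have solution_F: "Y \<in> F ` Pow A" if "Y \<in> ?S" for Y
  proof -
    have Y: "Y \<subseteq> carrier G" and eq: "Y <#> {\<one>, c} = ?T"
      using that by (auto simp: carrier_power_monoid_fin1_iff)
    note split = in_mult_doubleton_iff[OF Y, of _ c, unfolded eq]
    \<comment> \<open>If \<open>x c\<^sup>3\<close> were in \<open>Y\<close>, then \<open>x c\<^sup>4\<close> would be in the product, which stops at \<open>A c\<^sup>3\<close>.\<close>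
    have no_top: "x \<otimes> c [^] (3::nat) \<notin> Y" if x: "x \<in> A" for x
    proof
      assume "x \<otimes> c [^] (3::nat) \<in> Y"
      then have "x \<otimes> c [^] Suc 3 \<in> ?T" using split pow(3)[OF x, of 3] by metis
      then obtain x' i where "x' \<in> A" "i \<le> (3::nat)" "x \<otimes> c [^] Suc 3 = x' \<otimes> c [^] i"
        unfolding T_iff by blast
      then show False using disj[of x x' "Suc 3" i] x by simp
    qed
    have Y_pow: "\<exists>x\<in>A. \<exists>i\<le>2::nat. y = x \<otimes> c [^] i" if y: "y \<in> Y" for y
    proof -
      have "y \<in> ?T" using split y by blast
      then obtain x i where x: "x \<in> A" "i \<le> (3::nat)" "y = x \<otimes> c [^] i" unfolding T_iff by blast
      with no_top[of x] y have "i \<noteq> 3" by blast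
      with x show ?thesis by (intro bexI[of _ x] exI[of _ i]) auto
    qed
    \<comment> \<open>An element of \<open>A\<close> in the product is not of the form \<open>y c\<close> with \<open>y\<close> in \<open>Y\<close>.\<close>
    have bottom: "x \<in> Y" if x: "x \<in> A" for x
    proof (rule ccontr)
      assume "x \<notin> Y"
      moreover have "x \<in> ?T" unfolding T_iff using x pow(1)[of x] by (intro bexI[of _ x] exI[of _ 0]) auto
      ultimately obtain y where y: "y \<in> Y" "x = y \<otimes> c" using split by blast
      then obtain x' i where x': "x' \<in> A" "y = x' \<otimes> c [^] (i::nat)" using Y_pow[OF y(1)] by blast
      then have "x' \<otimes> c [^] Suc i \<in> A" using x y pow(3) by metis
      then show False using off[of x' "Suc i"] x' by blast
    qed
    \<comment> \<open>\<open>x c\<^sup>3\<close> is in the product but not in \<open>Y\<close>, so it arises from \<open>x c\<^sup>2\<close>.\<close>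
    have middle: "x \<otimes> c [^] (2::nat) \<in> Y" if x: "x \<in> A" for x
    proof -
      have "x \<otimes> c [^] (3::nat) \<in> ?T" unfolding T_iff using x by blast
      then obtain y where y: "y \<in> Y" "x \<otimes> c [^] (3::nat) = y \<otimes> c"
        using split no_top[OF x] by blast
      have "x \<otimes> c [^] (3::nat) = x \<otimes> c [^] (2::nat) \<otimes> c"
        using pow(3)[OF x, of 2] by simp
      then have "y = x \<otimes> c [^] (2::nat)"
        using r_cancel[of y c "x \<otimes> c [^] (2::nat)"] y x sub Y c
        by (metis m_closed nat_pow_closed subsetD)
      then show ?thesis using y by simp
    qed
    have "Y = F {x \<in> A. x \<otimes> c \<in> Y}"
    proof
      show "F {x \<in> A. x \<otimes> c \<in> Y} \<subseteq> Y" using bottom middle by (auto simp: F_def)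
      show "Y \<subseteq> F {x \<in> A. x \<otimes> c \<in> Y}"
      proof
        fix y assume y: "y \<in> Y"
        then obtain x i where x: "x \<in> A" "i \<le> (2::nat)" "y = x \<otimes> c [^] i" using Y_pow[OF y] by blast
        consider "i = 0" | "i = 1" | "i = 2" using x(2) by linarith
        then show "y \<in> F {x \<in> A. x \<otimes> c \<in> Y}"
        proof cases
          case 1 then show ?thesis using x pow(1)[of x] by (simp add: F_def)
        next
          case 2
          then have "y = x \<otimes> c" using x pow(2)[of x] by simp
          then show ?thesis using x(1) y by (auto simp: F_def)
        next
          case 3 then show ?thesis using x by (simp add: F_def)
        qed
      qed
    qed
    then show ?thesis by blast
  qed
  have "?S = F ` Pow A" using F_solution solution_F by blast
  then show ?thesis using card_image[OF inj] card_Pow[OF fin] by simp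
qed

end

section \<open>Isomorphisms of power monoids and their pullbacks\<close>

locale power_monoid_pullback =
  H: monoid_cancel H + K: monoid_cancel K
  for H :: "('a, 'm) monoid_scheme" and K :: "('b, 'n) monoid_scheme" +
  fixes f :: "'a set \<Rightarrow> 'b set" and g :: "'a \<Rightarrow> 'b"
  assumes iso: "f \<in> iso (power_monoid_fin1 H) (power_monoid_fin1 K)"
    and pullback: "is_pullback H K f g"
begin

abbreviation "PH \<equiv> carrier (power_monoid_fin1 H)"
abbreviation "PK \<equiv> carrier (power_monoid_fin1 K)"

lemma f_closed: "X \<in> PH \<Longrightarrow> f X \<in> PK"
  using iso by (auto simp: iso_def hom_def)

lemma f_mult: "X \<in> PH \<Longrightarrow> Y \<in> PH \<Longrightarrow> f (X <#>\<^bsub>H\<^esub> Y) = f X <#>\<^bsub>K\<^esub> f Y"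
  using iso hom_mult[of f "power_monoid_fin1 H" "power_monoid_fin1 K"]
  by (simp add: iso_def mult_power_monoid_fin1)

lemma f_bij: "bij_betw f PH PK"
  using iso by (simp add: iso_def)

lemma f_inj: "X \<in> PH \<Longrightarrow> Y \<in> PH \<Longrightarrow> f X = f Y \<longleftrightarrow> X = Y"
  using f_bij by (meson bij_betw_def inj_on_eq_iff)

lemma mult_closed: "X \<in> PH \<Longrightarrow> Y \<in> PH \<Longrightarrow> X <#>\<^bsub>H\<^esub> Y \<in> PH"
  using monoid.m_closed[OF H.power_monoid_fin1_is_monoid] by (simp add: mult_power_monoid_fin1)

lemma f_doubleton: "x \<in> carrier H \<Longrightarrow> f {\<one>\<^bsub>H\<^esub>, x} = {\<one>\<^bsub>K\<^esub>, g x}"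
  using pullback by (simp add: is_pullback_def)

lemma g_closed: "x \<in> carrier H \<Longrightarrow> g x \<in> carrier K"
  using pullback bij_betwE unfolding is_pullback_def by blast

lemma f_powers_upto:
  assumes a: "a \<in> carrier H" and "0 < n"
  shows "f (powers_upto H a n) = powers_upto K (g a) n"
  using \<open>0 < n\<close>
proof (induction n rule: nat_induct_non_zero)
  case 1
  then show ?case
    using a by (simp add: H.powers_upto_1 K.powers_upto_1 f_doubleton g_closed flip: One_nat_def)
next
  case (Suc n)
  then show ?case
    using a by (simp add: H.powers_upto_Suc K.powers_upto_Suc f_mult f_doubleton g_closed
        H.powers_upto_in_power_monoid H.doubleton_in_power_monoid)
qed

text \<open>
  A coincidence between powers of \<open>g a\<close> would make the increasing sequence \<open>{\<one>, g a}\<^sup>n\<close>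
  stationary, whereas the sets \<open>{\<one>, a}\<^sup>n\<close>, of which they are the images, are pairwise distinct.
\<close>

lemma has_infinite_order_pullback:
  assumes a: "a \<in> carrier H" and ord: "has_infinite_order H a"
  shows "has_infinite_order K (g a)"
proof -
  have neq: "g a [^]\<^bsub>K\<^esub> i \<noteq> g a [^]\<^bsub>K\<^esub> j" if "i < j" for i j :: nat
  proof
    assume "g a [^]\<^bsub>K\<^esub> i = g a [^]\<^bsub>K\<^esub> j"
    \<comment> \<open>With both exponents raised by one, the sets compared below have the indices \<open>j\<close> and
      \<open>Suc j\<close>. Both are positive, as the evaluation of \<open>f\<close> on such sets requires.\<close>
    then have "g a [^]\<^bsub>K\<^esub> Suc j = g a [^]\<^bsub>K\<^esub> Suc i" by simp
    moreover have "g a [^]\<^bsub>K\<^esub> Suc i \<in> (\<lambda>i. g a [^]\<^bsub>K\<^esub> i) ` {..j}"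
      by (rule imageI) (use that in simp)
    ultimately have "powers_upto K (g a) (Suc j) = powers_upto K (g a) j"
      unfolding powers_upto_def atMost_Suc image_insert by (simp only: insert_absorb)
    then have "powers_upto H a (Suc j) = powers_upto H a j"
      using f_powers_upto[OF a] f_inj H.powers_upto_in_power_monoid[OF a] that
      by (metis gr_implies_not0 not_gr_zero zero_less_Suc)
    then have "a [^]\<^bsub>H\<^esub> Suc j \<in> (\<lambda>i. a [^]\<^bsub>H\<^esub> i) ` {..j}"
      unfolding powers_upto_def by blast
    then show False
      using ord unfolding has_infinite_order_def inj_def
      by (metis atMost_iff imageE not_less_eq_eq order_refl)
  qed
  show ?thesis
    unfolding has_infinite_order_def inj_def using neq by (metis linorder_neqE_nat)
qed

text \<open>
  Applying \<open>f\<close> to \<open>{\<one>, a\<^sup>n} {\<one>, a}\<^sup>n = {\<one>, a}\<^bsup>2n\<^esup>\<close> yields the same identity with \<open>g a\<close> in place of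
  \<open>a\<close> and \<open>g (a\<^sup>n)\<close> in place of \<open>a\<^sup>n\<close>. It forces \<open>g (a\<^sup>n)\<close> to be a power of \<open>g a\<close>, and comparing the
  largest exponents on both sides leaves only the \<open>n\<close>-th one.
\<close>

lemma pullback_pow:
  assumes a: "a \<in> carrier H" and ord: "has_infinite_order H a" and n: "0 < (n::nat)"
  shows "g (a [^]\<^bsub>H\<^esub> n) = g a [^]\<^bsub>K\<^esub> n"
proof -
  let ?b = "g a" and ?d = "g (a [^]\<^bsub>H\<^esub> n)"
  have b: "?b \<in> carrier K" and an: "a [^]\<^bsub>H\<^esub> n \<in> carrier H" using a g_closed by auto
  have b_inj: "?b [^]\<^bsub>K\<^esub> i = ?b [^]\<^bsub>K\<^esub> j \<longleftrightarrow> i = j" for i j :: nat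
    using has_infinite_order_pullback[OF a ord] by (auto simp: has_infinite_order_def inj_eq)
  have "{\<one>\<^bsub>K\<^esub>, ?d} <#>\<^bsub>K\<^esub> powers_upto K ?b n = f ({\<one>\<^bsub>H\<^esub>, a [^]\<^bsub>H\<^esub> n} <#>\<^bsub>H\<^esub> powers_upto H a n)"
    using f_mult[OF H.doubleton_in_power_monoid[OF an] H.powers_upto_in_power_monoid[OF a]]
      f_doubleton[OF an] f_powers_upto[OF a n] by simp
  also have "\<dots> = powers_upto K ?b (2 * n)"
    using H.doubleton_pow_mult_powers_upto[OF a] f_powers_upto[OF a] n by simp
  finally have eq: "powers_upto K ?b n \<union> (\<lambda>x. ?d \<otimes>\<^bsub>K\<^esub> x) ` powers_upto K ?b n =
      powers_upto K ?b (2 * n)"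
    using K.doubleton_mult[of "powers_upto K ?b n" ?d] K.powers_upto_in_power_monoid[OF b]
    by (simp add: carrier_power_monoid_fin1_iff)
  have "?d \<otimes>\<^bsub>K\<^esub> \<one>\<^bsub>K\<^esub> \<in> powers_upto K ?b (2 * n)"
    using eq K.powers_upto_in_power_monoid[OF b, of n]
    unfolding carrier_power_monoid_fin1_iff by blast
  then obtain j :: nat where d: "?d = ?b [^]\<^bsub>K\<^esub> j"
    using g_closed[OF an] by (auto simp: powers_upto_def)
  have "?d \<otimes>\<^bsub>K\<^esub> ?b [^]\<^bsub>K\<^esub> n \<in> powers_upto K ?b (2 * n)"
    using eq unfolding powers_upto_def by blast
  then have "j \<le> n"
    using b b_inj by (auto simp: d powers_upto_def K.nat_pow_mult)
  moreover have "n \<le> j"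
  proof -
    have "?b [^]\<^bsub>K\<^esub> (2 * n) \<in> powers_upto K ?b n \<union> (\<lambda>x. ?d \<otimes>\<^bsub>K\<^esub> x) ` powers_upto K ?b n"
      unfolding eq by (simp add: powers_upto_def)
    then obtain i where "i \<le> n" "2 * n = i \<or> 2 * n = j + i"
      using b b_inj by (auto simp: d powers_upto_def K.nat_pow_mult)
    then show ?thesis using n by auto
  qed
  ultimately show ?thesis using d by simp
qed

text \<open>
  A single exponent \<open>n\<close> makes \<open>a\<^sup>n\<close> good for \<open>A\<close> and \<open>g (a\<^sup>n) = (g a)\<^sup>n\<close> good for \<open>f A\<close>. Then both
  sets are measured by the number of solutions of corresponding equations.
\<close>

lemma card_preserved:
  assumes a: "a \<in> carrier H" and ord: "has_infinite_order H a" and A: "A \<in> PH"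
  shows "card (f A) = card A"
proof -
  have b: "g a \<in> carrier K" and ordb: "has_infinite_order K (g a)"
    using a ord g_closed has_infinite_order_pullback by auto
  obtain M where M: "\<And>m x. M < (m::nat) \<Longrightarrow> x \<in> A \<Longrightarrow> x \<otimes>\<^bsub>H\<^esub> a [^]\<^bsub>H\<^esub> m \<notin> A"
    using H.large_powers_translate_off[OF a ord, of A] A
    unfolding carrier_power_monoid_fin1_iff by blast
  obtain M' where M': "\<And>m x. M' < (m::nat) \<Longrightarrow> x \<in> f A \<Longrightarrow> x \<otimes>\<^bsub>K\<^esub> g a [^]\<^bsub>K\<^esub> m \<notin> f A"
    using K.large_powers_translate_off[OF b ordb, of "f A"] f_closed[OF A]
    unfolding carrier_power_monoid_fin1_iff by blast
  define n where "n = Suc (max M M')"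
  define c where "c = a [^]\<^bsub>H\<^esub> n"
  have c: "c \<in> carrier H" and gc: "g c \<in> carrier K"
    using a g_closed by (simp_all add: c_def)
  have gc_eq: "g c = g a [^]\<^bsub>K\<^esub> n"
    unfolding c_def by (rule pullback_pow[OF a ord]) (simp add: n_def)
  \<comment> \<open>All powers \<open>c\<^sup>k\<close> with \<open>k > 0\<close> then have exponents beyond both bounds.\<close>
  have large: "M < n * k" "M' < n * k" if "0 < k" for k
  proof -
    have "n \<le> n * k" using that by simp
    then show "M < n * k" "M' < n * k" unfolding n_def by linarith+
  qed
  let ?S = "{Y \<in> PH. Y <#>\<^bsub>H\<^esub> {\<one>\<^bsub>H\<^esub>, c} = A <#>\<^bsub>H\<^esub> powers_upto H c 3}"
  let ?S' = "{Y \<in> PK. Y <#>\<^bsub>K\<^esub> {\<one>\<^bsub>K\<^esub>, g c} = f A <#>\<^bsub>K\<^esub> powers_upto K (g c) 3}"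
  have "card ?S = 2 ^ card A"
    using c A M large a
    by (intro H.card_cube_roots_of_translates) (auto simp: c_def H.nat_pow_pow)
  moreover have "card ?S' = 2 ^ card (f A)"
    using gc f_closed[OF A] M' large b
    by (intro K.card_cube_roots_of_translates) (auto simp: gc_eq K.nat_pow_pow)
  moreover have "card ?S' = card ?S"
  proof -
    have iff: "f Y <#>\<^bsub>K\<^esub> {\<one>\<^bsub>K\<^esub>, g c} = f A <#>\<^bsub>K\<^esub> powers_upto K (g c) 3 \<longleftrightarrow>
        Y <#>\<^bsub>H\<^esub> {\<one>\<^bsub>H\<^esub>, c} = A <#>\<^bsub>H\<^esub> powers_upto H c 3" if Y: "Y \<in> PH" for Y
    proof -
      note dc = H.doubleton_in_power_monoid[OF c] and pc = H.powers_upto_in_power_monoid[OF c, of 3]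
      show ?thesis
        using f_inj[OF mult_closed[OF Y dc] mult_closed[OF A pc]] f_mult[OF Y dc] f_mult[OF A pc]
          f_doubleton[OF c] f_powers_upto[OF c, of 3] by simp
    qed
    have "?S' = f ` ?S"
      unfolding bij_betw_imp_surj_on[OF f_bij, symmetric] using iff by fast
    moreover have "inj_on f ?S"
      using f_inj by (auto intro: inj_onI)
    ultimately show ?thesis by (simp add: card_image)
  qed
  ultimately show ?thesis by simp
qed

end

theorem proposition2p7:
  fixes H :: "('a, 'm) monoid_scheme" and K :: "('b, 'n) monoid_scheme"
    and f :: "'a set \<Rightarrow> 'b set" and g :: "'a \<Rightarrow> 'b"
  assumes "monoid_cancel H" and "monoid_cancel K"
    and "\<exists>a \<in> carrier H. has_infinite_order H a"
    and "f \<in> iso (power_monoid_fin1 H) (power_monoid_fin1 K)"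
    and "is_pullback H K f g"
  shows "\<forall>h \<in> carrier H. \<forall>A \<in> carrier (power_monoid_fin1 H).
    autocorrelation H h A = autocorrelation K (g h) (f A)"
proof (intro ballI)
  fix h A
  assume h: "h \<in> carrier H" and A: "A \<in> carrier (power_monoid_fin1 H)"
  interpret power_monoid_pullback H K f g
    using assms by (simp add: power_monoid_pullback_def power_monoid_pullback_axioms_def)
  obtain a where a: "a \<in> carrier H" "has_infinite_order H a"
    using assms(3) by blast
  note dh = H.doubleton_in_power_monoid[OF h]
  have "card ({\<one>\<^bsub>K\<^esub>, g h} <#>\<^bsub>K\<^esub> f A) = card (f ({\<one>\<^bsub>H\<^esub>, h} <#>\<^bsub>H\<^esub> A))"
    using f_mult[OF dh A] f_doubleton[OF h] by simp
  also have "\<dots> = card ({\<one>\<^bsub>H\<^esub>, h} <#>\<^bsub>H\<^esub> A)"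
    by (rule card_preserved[OF a mult_closed[OF dh A]])
  finally show "autocorrelation H h A = autocorrelation K (g h) (f A)"
    using H.card_doubleton_mult_plus_autocorrelation[OF h A]
      K.card_doubleton_mult_plus_autocorrelation[OF g_closed[OF h] f_closed[OF A]]
      card_preserved[OF a A] by simp
qed

end
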